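(* Let $p>2$ be a prime, let $t$ be a positive divisor of $p-1$, let $k$ be an integer with $1<k<p/2$, and let $a\in\mathbb{F}_p^*$. Put $r_0(k)=\left\lfloor \frac{\log(p/2)}{\log k}\right\rfloor$ and $s=s_0(k,t)=\max\left\{s'\in\mathbb{Z}_{\ge 0}~:~\binom{r_0(k)+s'}{s'}\le t\right\}$. Then $$\#\{|x|~:~x\in U(k,t,a)\}\le\Psi(k,p_{s+1}).$$
   Context: $\mathbb{F}_p$ is the field of residues modulo $p$ and $\mathbb{F}_p^*=\mathbb{F}_p\setminus\{0\}$. For $x\in\mathbb{F}_p$ its integer height is $|x|=\min\{|a|~:~a\in\mathbb{Z},\ a\equiv x \pmod p\}$. For $t\mid p-1$, $G$ denotes the unique subgroup of $\mathbb{F}_p^*$ of order $t$, and $aG=\{ag~:~g\in G\}$. Define $U(k,t,a)=\{x\in aG~:~|x|\le k\}$. $\Psi(x,y)$ is the number of positive integers $n\le x$ all of whose prime factors are at most $y$. $p_j$ denotes the $j$-th prime ($p_1=2$). *)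

theory Defs
  imports "HOL-Number_Theory.Residues" "HOL-Library.Infinite_Set"
begin

abbreviation Fp :: "nat \<Rightarrow> int ring" where
  "Fp p \<equiv> residue_ring (int p)"

abbreviation Fp_star :: "nat \<Rightarrow> int monoid" where
  "Fp_star p \<equiv> mult_of (Fp p)"

definition height :: "nat \<Rightarrow> int \<Rightarrow> nat" where
  "height p x = (LEAST h. \<exists>b::int. [b = x] (mod int p) \<and> h = nat \<bar>b\<bar>)"

text \<open>Well-defined for prime \<open>p\<close> and \<open>t\<close> dividing \<open>p - 1\<close>, see \<open>ex1_subgroup_of_order\<close> below.\<close>

definition subgroup_of_order :: "nat \<Rightarrow> nat \<Rightarrow> int set" where
  "subgroup_of_order p t = (THE G. subgroup G (Fp_star p) \<and> card G = t)"

definition U :: "nat \<Rightarrow> nat \<Rightarrow> nat \<Rightarrow> int \<Rightarrow> int set" where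
  "U p k t a = {x \<in> a <#\<^bsub>Fp_star p\<^esub> subgroup_of_order p t. height p x \<le> k}"

definition smooth_count :: "real \<Rightarrow> real \<Rightarrow> nat" where
  "smooth_count x y =
     card {n::nat. 0 < n \<and> real n \<le> x \<and> (\<forall>q \<in> prime_factors n. real q \<le> y)}"

text \<open>Primes are indexed from 1, whereas \<open>enumerate\<close> counts from 0.\<close>

definition nth_prime :: "nat \<Rightarrow> nat" where
  "nth_prime j = enumerate {q::nat. prime q} (j - 1)"

definition r0 :: "nat \<Rightarrow> nat \<Rightarrow> nat" where
  "r0 p k = nat \<lfloor>ln (real p / 2) / ln (real k)\<rfloor>"

definition s0 :: "nat \<Rightarrow> nat \<Rightarrow> nat \<Rightarrow> nat" where
  "s0 p k t = Max {s'. (r0 p k + s') choose s' \<le> t}"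

lemma ex1_subgroup_of_order:
  assumes "prime p" and "t > 0" and "t dvd p - 1"
  shows "\<exists>!G. subgroup G (Fp_star p) \<and> card G = t"
proof -
  interpret residues_prime p "Fp p"
    by (simp add: residues_prime_def assms)
  interpret M: group "Fp_star p"
    by (rule field_mult_group)
  have fin: "finite (carrier (Fp p))"
    by (rule finite)
  have finM: "finite (carrier (Fp_star p))"
    using fin by simp
  have p1: "p > 1"
    using assms(1) prime_gt_1_nat by blast
  have ord: "card (carrier (Fp_star p)) = p - 1"
  proof -
    have "order (Fp p) = p"
      by (simp add: order_def residue_ring_def)
    then show ?thesis
      using order_mult_of[OF fin] by (simp add: order_def)
  qed
  obtain g where g: "g \<in> carrier (Fp_star p)"
    and gen: "carrier (Fp_star p) = {g [^]\<^bsub>Fp p\<^esub> i | i::nat. i \<in> UNIV}"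
    using finite_field_mult_group_has_gen[OF fin] by blast
  have "generate (Fp_star p) {g} = carrier (Fp_star p)"
    using M.generate_pow_on_finite_carrier[OF finM g] gen by (simp add: nat_pow_mult_of)
  then have og: "M.ord g = p - 1"
    using M.generate_pow_card[OF g] ord by simp
  define d where "d = (p - 1) div t"
  have td: "p - 1 = t * d"
    using assms(3) d_def by simp
  have "t * d > 0"
    using td p1 by linarith
  then have d0: "d \<noteq> 0"
    by simp
  have dg: "d dvd M.ord g"
    unfolding og td by (rule dvd_triv_right)
  define b where "b = g [^]\<^bsub>Fp_star p\<^esub> d"
  have b: "b \<in> carrier (Fp_star p)"
    unfolding b_def using g by (rule M.nat_pow_closed)
  have "M.ord b = t"
    unfolding b_def M.ord_pow[OF g dg d0] og td using d0 by simp
  then have ex: "subgroup (generate (Fp_star p) {b}) (Fp_star p) \<and> card (generate (Fp_star p) {b}) = t"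
    using M.generate_is_subgroup[of "{b}"] M.generate_pow_card[OF b] b by simp
  define S where "S = {x \<in> carrier (Fp p). x [^]\<^bsub>Fp p\<^esub> t = \<one>\<^bsub>Fp p\<^esub>}"
  have S: "card S \<le> t" "finite S"
    using num_roots_le_deg[OF fin, of t] assms(2) fin by (auto simp: S_def)
  have "H = S" if H: "subgroup H (Fp_star p)" "card H = t" for H
  proof -
    interpret H: group "Fp_star p\<lparr>carrier := H\<rparr>"
      by (rule M.subgroup_imp_group[OF H(1)])
    have sub: "H \<subseteq> carrier (Fp_star p)"
      using H(1) by (rule subgroup.subset)
    have "H \<subseteq> S"
    proof
      fix x assume x: "x \<in> H"
      have "x [^]\<^bsub>Fp_star p\<lparr>carrier := H\<rparr>\<^esub> t = \<one>\<^bsub>Fp_star p\<lparr>carrier := H\<rparr>\<^esub>"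
        using H.pow_order_eq_1[of x] x H(2) by (simp add: order_def)
      then have "x [^]\<^bsub>Fp_star p\<^esub> t = \<one>\<^bsub>Fp_star p\<^esub>"
        using M.nat_pow_consistent[of x t H] by simp
      then show "x \<in> S"
        using sub x by (auto simp: S_def nat_pow_mult_of)
    qed
    then show ?thesis
      using S H(2) by (intro card_seteq) auto
  qed
  then show ?thesis
    using ex by (intro ex_ex1I) blast+
qed

lemma s0_set_finite_nonempty:
  assumes "1 < k" and "real k < real p / 2" and "t > 0"
  shows "finite {s'. (r0 p k + s') choose s' \<le> t}" and "0 \<in> {s'. (r0 p k + s') choose s' \<le> t}"
proof -
  have "1 \<le> ln (real p / 2) / ln (real k)"
    using assms by simp
  then have r: "1 \<le> r0 p k"
    unfolding r0_def by linarith
  have "s' \<le> t" if "(r0 p k + s') choose s' \<le> t" for s'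
  proof -
    have "Suc s' choose s' \<le> (r0 p k + s') choose s'"
      using r by (intro binomial_right_mono) auto
    then show ?thesis
      using that by simp
  qed
  then have "{s'. (r0 p k + s') choose s' \<le> t} \<subseteq> {..t}"
    by blast
  then show "finite {s'. (r0 p k + s') choose s' \<le> t}"
    by (rule finite_subset) simp
  show "0 \<in> {s'. (r0 p k + s') choose s' \<le> t}"
    using assms by simp
qed

end

theory Submission
  imports Defs "HOL-Library.Function_Algebras"
begin

text \<open>
  Let \<open>H\<close> be the set of heights and \<open>r = r0 p k\<close>. Up to sign, every product of \<open>r\<close> elements of \<open>H\<close>
  lies in the single coset \<open>a\<^sup>r G\<close>, and since such products are at most \<open>k\<^sup>r \<le> p / 2\<close>, distinct
  integers give distinct elements of it; hence there are at most \<open>t\<close> of them. If \<open>H\<close> contains \<open>m + 1\<close>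
  multiplicatively independent integers, these alone have \<open>(r + m) choose m\<close> distinct products, so
  \<open>m \<le> s\<close>: the exponent vectors of the elements of \<open>H\<close> span a space of dimension at most \<open>s + 1\<close>.
  Some \<open>s + 1\<close> coordinates, i.e. primes, determine all vectors of this space. Dropping the other
  primes and replacing the chosen ones, in increasing order, by the first \<open>s + 1\<close> primes only
  decreases a number, and thus injects \<open>H\<close> into the \<open>p\<^bsub>s+1\<^esub>\<close>-smooth numbers up to \<open>k\<close>.
\<close>

section \<open>Coordinates that determine a finite-dimensional function space\<close>

interpretation funs: vector_space "\<lambda>(c::'a::field) (f::'b \<Rightarrow> 'a) x. c * f x"
  by unfold_locales (auto simp: fun_eq_iff algebra_simps)

text \<open>A new generator \<open>b\<close> costs at most one new coordinate: the functions in the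
  larger span that vanish on \<open>Q\<close> meet \<open>funs.span B\<close> only in 0, so they
  form at most a line, and any coordinate where some such \<open>f\<close> is nonzero cuts this line
  down to 0.\<close>

lemma span_determined_by_few_coordinates:
  fixes B :: "('b \<Rightarrow> 'a::field) set"
  assumes "finite B"
  shows "\<exists>Q. finite Q \<and> card Q \<le> card B \<and>
           (\<forall>f \<in> funs.span B. (\<forall>q\<in>Q. f q = 0) \<longrightarrow> f = 0)"
  using assms
proof (induction B rule: finite_induct)
  case empty
  then show ?case by (intro exI[of _ "{}"]) simp
next
  case (insert b B)
  then obtain Q where Q: "finite Q" "card Q \<le> card B"
    "\<And>f. f \<in> funs.span B \<Longrightarrow> \<forall>q\<in>Q. f q = 0 \<Longrightarrow> f = 0" by blast
  show ?case
  proof (cases "\<forall>f \<in> funs.span (insert b B). (\<forall>q\<in>Q. f q = 0) \<longrightarrow> f = 0")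
    case True
    then show ?thesis using Q(1,2) insert.hyps by (intro exI[of _ Q] conjI) (assumption | simp)+
  next
    case False
    then obtain f where f: "f \<in> funs.span (insert b B)" "\<forall>q\<in>Q. f q = 0" "f \<noteq> 0" by blast
    then obtain q where q: "f q \<noteq> 0" by (auto simp: fun_eq_iff)
    obtain c where c: "f - (\<lambda>x. c * b x) \<in> funs.span B"
      using f(1) funs.span_breakdown_eq[of f b B] by blast
    have "c \<noteq> 0"
    proof
      assume "c = 0"
      then have "f - (\<lambda>x. c * b x) = f" by (simp add: fun_eq_iff)
      then show False using c Q(3) f by metis
    qed
    have "g = 0" if g: "g \<in> funs.span (insert b B)" "\<forall>x\<in>insert q Q. g x = 0" for g
    proof -
      obtain d where d: "g - (\<lambda>x. d * b x) \<in> funs.span B"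
        using g(1) funs.span_breakdown_eq[of g b B] by blast
      \<comment> \<open>Modulo \<open>funs.span B\<close>, \<open>f\<close> is \<open>c * b\<close>
        and \<open>g\<close> is \<open>d * b\<close>. This combination cancels \<open>b\<close> and
        still vanishes on \<open>Q\<close>, so it is 0; hence \<open>g\<close> is a multiple of
        \<open>f\<close>, and coordinate \<open>q\<close> forces the factor to be 0.\<close>
      define u where "u = g - (\<lambda>x. (d / c) * f x)"
      have "u = (g - (\<lambda>x. d * b x)) - (\<lambda>x. (d / c) * (f - (\<lambda>x. c * b x)) x)"
        using \<open>c \<noteq> 0\<close> by (auto simp: u_def fun_eq_iff field_simps)
      also have "\<dots> \<in> funs.span B"
        by (intro funs.span_diff funs.span_scale c d)
      finally have "u = 0"
        by (rule Q(3)) (use g f in \<open>auto simp: u_def\<close>)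
      then have *: "g x = (d / c) * f x" for x
        by (auto simp: u_def fun_eq_iff)
      then have "d / c = 0" using g(2) q by (metis insertI1 mult_eq_0_iff)
      then show ?thesis using * by (auto simp: fun_eq_iff)
    qed
    moreover have "card (insert q Q) \<le> card (insert b B)"
      using Q insert.hyps by (simp add: card_insert_if)
    ultimately show ?thesis using Q(1) by (intro exI[of _ "insert q Q"] conjI ballI impI) (assumption | simp)+
  qed
qed

section \<open>Exponent vectors and multiplicative independence\<close>

text \<open>Rational values make multiplicative independence linear independence over a field.
  Coordinates at non-primes are always 0.\<close>

definition exponent_vector :: "nat \<Rightarrow> nat \<Rightarrow> rat" where
  "exponent_vector n q = of_nat (count (prime_factorization n) q)"

lemma exponent_vector_eq_iff:
  assumes "m > 0" "n > 0"
  shows "exponent_vector m = exponent_vector n \<longleftrightarrow> m = n"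
proof
  assume "exponent_vector m = exponent_vector n"
  then have "prime_factorization m = prime_factorization n"
    by (auto simp: exponent_vector_def fun_eq_iff multiset_eq_iff)
  then show "m = n" using assms by (simp add: prime_factorization_unique)
qed simp

lemma exponent_vector_prod_mset:
  assumes "0 \<notin> A" "finite A" "set_mset M \<subseteq> A"
  shows "exponent_vector (prod_mset M) q = (\<Sum>x\<in>A. of_nat (count M x) * exponent_vector x q)"
  using assms(3)
proof (induction M)
  case empty
  then show ?case by (simp add: exponent_vector_def)
next
  case (add y M)
  have nz: "y \<noteq> 0" "prod_mset M \<noteq> 0" using add.prems assms(1) by (auto intro: gr0I)
  have "exponent_vector (prod_mset (add_mset y M)) q
      = exponent_vector y q + exponent_vector (prod_mset M) q"
    using nz by (simp add: exponent_vector_def prime_factorization_mult)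
  also have "exponent_vector y q = (\<Sum>x\<in>A. if x = y then exponent_vector x q else 0)"
    using add.prems assms(2) by (simp add: sum.delta)
  also have "exponent_vector (prod_mset M) q
      = (\<Sum>x\<in>A. of_nat (count M x) * exponent_vector x q)"
    using add by simp
  finally show ?case
    by (simp add: sum.distrib[symmetric]) (auto intro!: sum.cong simp: algebra_simps)
qed

text \<open>Equal products give a linear relation between the exponent vectors of \<open>A\<close>,
  whose coefficients are the differences of multiplicities; independence makes them all 0.\<close>

lemma inj_on_prod_mset_independent:
  assumes "0 \<notin> A" "finite A" "funs.independent (exponent_vector ` A)"
  shows "inj_on prod_mset {M. set_mset M \<subseteq> A}"
proof (rule inj_onI; clarify)
  fix M N :: "nat multiset"
  assume MN: "set_mset M \<subseteq> A" "set_mset N \<subseteq> A" "prod_mset M = prod_mset N"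
  have inj: "inj_on exponent_vector A"
    using assms(1) by (metis exponent_vector_eq_iff inj_onI neq0_conv)
  define c where "c x = rat_of_nat (count M x) - rat_of_nat (count N x)" for x
  \<comment> \<open>Linear dependence indexes coefficients by vectors, so \<open>c\<close> is
    transported along the inverse of \<open>exponent_vector\<close>, which is injective on
    \<open>A\<close>.\<close>
  define u where "u = c \<circ> the_inv_into A exponent_vector"
  have "(\<Sum>v\<in>exponent_vector ` A. (\<lambda>q. u v * v q)) = (\<Sum>x\<in>A. (\<lambda>q. c x * exponent_vector x q))"
    unfolding sum.reindex[OF inj]
    by (rule sum.cong) (simp_all add: u_def the_inv_into_f_f[OF inj])
  also have "\<dots> = 0"
  proof
    fix q
    have sum_apply: "(\<Sum>x\<in>A. (\<lambda>q. c x * exponent_vector x q)) q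
        = (\<Sum>x\<in>A. c x * exponent_vector x q)"
      using assms(2) by (induction A rule: finite_induct) auto
    have "(\<Sum>x\<in>A. c x * exponent_vector x q)
        = exponent_vector (prod_mset M) q - exponent_vector (prod_mset N) q"
      using exponent_vector_prod_mset[OF assms(1,2)] MN(1,2)
      by (simp add: c_def left_diff_distrib sum_subtractf)
    then show "(\<Sum>x\<in>A. (\<lambda>q. c x * exponent_vector x q)) q = 0 q"
      using MN(3) sum_apply by simp
  qed
  finally have "\<forall>v\<in>exponent_vector ` A. u v = 0"
    using assms(2,3) funs.dependent_finite[of "exponent_vector ` A"] by blast
  then have "c x = 0" if "x \<in> A" for x
    using that by (auto simp: u_def the_inv_into_f_f[OF inj])
  then have "count M x = count N x" if "x \<in> A" for x
    using that by (simp add: c_def)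
  moreover have "count M x = count N x" if "x \<notin> A" for x
    using that MN by (metis not_in_iff subsetD)
  ultimately show "M = N" by (auto simp: multiset_eq_iff)
qed

section \<open>Compression to smooth numbers\<close>

text \<open>If \<open>q\<close> has index \<open>n\<close> among the primes, the elements of
  \<open>Q\<close> below \<open>q\<close> are among the \<open>n\<close> primes of smaller
  index.\<close>

lemma prime_ge_enumerate_card_less:
  fixes q :: nat
  assumes "prime q" "Q \<subseteq> {q. prime q}"
  shows "enumerate {q. prime q} (card {x\<in>Q. x < q}) \<le> q"
proof -
  let ?P = "{q::nat. prime q}"
  have inf: "infinite ?P" by (rule primes_infinite)
  obtain n where n: "q = enumerate ?P n"
    using enumerate_Ex[of ?P q] inf assms by auto
  have "{x\<in>Q. x < q} \<subseteq> enumerate ?P ` {..<n}"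
  proof
    fix x assume x: "x \<in> {x\<in>Q. x < q}"
    then obtain m where m: "x = enumerate ?P m"
      using enumerate_Ex[of ?P x] inf assms by auto
    then have "m < n" using x inf n by auto
    then show "x \<in> enumerate ?P ` {..<n}" using m by blast
  qed
  then have "card {x\<in>Q. x < q} \<le> n"
    by (metis card_lessThan finite_lessThan surj_card_le)
  then show ?thesis using n inf by simp
qed

lemma prime_factorization_prod_prime_powers:
  fixes \<phi> :: "'a \<Rightarrow> nat"
  assumes "finite Q" "\<And>q. q \<in> Q \<Longrightarrow> prime (\<phi> q)"
  shows "prime_factorization (\<Prod>q\<in>Q. \<phi> q ^ e q) = (\<Sum>q\<in>Q. replicate_mset (e q) (\<phi> q))"
  using assms
proof (induction Q rule: finite_induct)
  case (insert q Q)
  have "\<phi> q \<noteq> 0" "\<forall>x\<in>Q. \<phi> x \<noteq> 0" using insert.prems by (metis insertCI not_prime_0)+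
  then show ?case using insert by (simp add: prime_factorization_mult prime_factorization_prime_power)
qed simp

text \<open>Distinct primes of \<open>Q\<close> get distinct replacements, so the exponents at
  \<open>Q\<close> can be read off the new number, and by \<open>det\<close> they recover the old
  one.\<close>

lemma card_le_smooth_count:
  assumes H: "H \<subseteq> {1..k}"
    and Q: "finite Q" "Q \<subseteq> {q. prime q}" "card Q \<le> s + 1"
    and det: "\<And>m n. m \<in> H \<Longrightarrow> n \<in> H \<Longrightarrow>
        (\<And>q. q \<in> Q \<Longrightarrow> multiplicity q m = multiplicity q n) \<Longrightarrow> m = n"
  shows "card H \<le> smooth_count (real k) (real (nth_prime (s + 1)))"
proof -
  let ?P = "{q::nat. prime q}"
  have inf: "infinite ?P" by (rule primes_infinite)
  \<comment> \<open>Ranks in \<open>Q\<close> start at 0, as \<open>enumerate\<close> does. The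
    largest rank is at most \<open>s\<close>, and index \<open>s\<close> is the prime
    \<open>nth_prime (s + 1)\<close>.\<close>
  define \<phi> where "\<phi> q = enumerate ?P (card {x\<in>Q. x < q})" for q
  have \<phi>_prime: "prime (\<phi> q)" for q
    using enumerate_in_set[OF inf] by (auto simp: \<phi>_def)
  have \<phi>_le: "\<phi> q \<le> q" if "q \<in> Q" for q
    using that Q(2) prime_ge_enumerate_card_less by (auto simp: \<phi>_def)
  have \<phi>_bound: "\<phi> q \<le> nth_prime (s + 1)" if "q \<in> Q" for q
  proof -
    have "card {x\<in>Q. x < q} < card Q"
      using that Q(1) by (intro psubset_card_mono) auto
    then show ?thesis using Q(3) inf by (simp add: \<phi>_def nth_prime_def)
  qed
  have \<phi>_less: "\<phi> q < \<phi> q'" if "q \<in> Q" "q < q'" for q q'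
  proof -
    have "card {x\<in>Q. x < q} < card {x\<in>Q. x < q'}"
      using that Q(1) by (intro psubset_card_mono) auto
    then show ?thesis using inf by (simp add: \<phi>_def)
  qed
  have \<phi>_inj: "inj_on \<phi> Q"
    using \<phi>_less by (metis inj_onI less_irrefl linorder_less_linear)
  define f where "f n = (\<Prod>q\<in>Q. \<phi> q ^ multiplicity q n)" for n
  have pf: "prime_factorization (f n) = (\<Sum>q\<in>Q. replicate_mset (multiplicity q n) (\<phi> q))" for n
    unfolding f_def using Q(1) \<phi>_prime by (intro prime_factorization_prod_prime_powers)
  have "count (prime_factorization (f n)) (\<phi> q) = multiplicity q n" if "q \<in> Q" for q n
  proof -
    have "count (prime_factorization (f n)) (\<phi> q)
        = (\<Sum>x\<in>Q. if x = q then multiplicity q n else 0)"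
      unfolding pf count_sum using that \<phi>_inj
      by (intro sum.cong) (auto simp: inj_on_eq_iff)
    then show ?thesis using that Q(1) by simp
  qed
  then have "inj_on f H"
    using det by (metis inj_onI)
  moreover have "f ` H \<subseteq>
    {n. 0 < n \<and> real n \<le> real k \<and> (\<forall>q\<in>prime_factors n. real q \<le> real (nth_prime (s + 1)))}"
  proof (clarify, intro conjI ballI)
    fix n assume n: "n \<in> H"
    then have n0: "n \<noteq> 0" "n \<le> k" using H by auto
    show "0 < f n" unfolding f_def using \<phi>_prime by (intro prod_pos) (simp add: prime_gt_0_nat)
    have "f n \<le> (\<Prod>q\<in>Q. q ^ multiplicity q n)"
      unfolding f_def using \<phi>_le by (intro prod_mono) (auto intro: power_mono)
    also have "\<dots> \<le> n"
    proof (rule dvd_imp_le)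
      \<comment> \<open>Primes of \<open>Q\<close> that do not divide \<open>n\<close> contribute a
        factor 1; what remains is part of the factorization of \<open>n\<close>.\<close>
      have "(\<Prod>q\<in>Q. q ^ multiplicity q n) = (\<Prod>q\<in>Q \<inter> prime_factors n. q ^ multiplicity q n)"
        using Q(1,2) by (intro prod.mono_neutral_right) (auto simp: prime_factors_multiplicity)
      also have "\<dots> dvd (\<Prod>q\<in>prime_factors n. q ^ multiplicity q n)"
        by (intro prod_dvd_prod_subset) auto
      also have "\<dots> = n"
        using prod_prime_factors[OF n0(1)] by simp
      finally show "(\<Prod>q\<in>Q. q ^ multiplicity q n) dvd n" .
    qed (use n0 in simp)
    finally show "real (f n) \<le> real k" using n0 by simp
    fix q assume "q \<in> prime_factors (f n)"
    then obtain x where "x \<in> Q" "q = \<phi> x"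
      using Q(1) by (auto simp: pf set_mset_sum split: if_splits)
    then show "real q \<le> real (nth_prime (s + 1))" using \<phi>_bound by simp
  qed
  moreover have "finite {n. 0 < n \<and> real n \<le> real k \<and>
      (\<forall>q\<in>prime_factors n. real q \<le> real (nth_prime (s + 1)))}"
    by (rule finite_subset[of _ "{..k}"]) auto
  ultimately show ?thesis unfolding smooth_count_def by (intro card_inj_on_le)
qed

section \<open>Products of heights in one coset\<close>

lemma height_cong:
  "[int (height p x) = x] (mod int p) \<or> [- int (height p x) = x] (mod int p)"
proof -
  have "\<exists>b::int. [b = x] (mod int p) \<and> height p x = nat \<bar>b\<bar>"
    unfolding height_def by (rule LeastI_ex) (use cong_refl in blast)
  then obtain b where b: "[b = x] (mod int p)" "height p x = nat \<bar>b\<bar>" by blast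
  then have "b = int (height p x) \<or> b = - int (height p x)" by linarith
  then show ?thesis using b(1) by auto
qed

text \<open>Integer congruences are used throughout because a height represents its residue only up
  to sign, and the sign has to be carried through the products.\<close>

lemma card_height_products_le:
  assumes "finite G" "1 \<in> G"
    and mult: "\<And>g h. g \<in> G \<Longrightarrow> h \<in> G \<Longrightarrow> (g * h) mod int p \<in> G"
    and H: "\<And>h. h \<in> H \<Longrightarrow> \<exists>g\<in>G. [int h = a * g] (mod int p) \<or> [- int h = a * g] (mod int p)"
    and pos: "H \<subseteq> {1..k}" and kr: "2 * k ^ r \<le> p"
  shows "card (prod_mset ` multisets_of_size H r) \<le> card G"
proof -
  let ?R = "\<lambda>n r g. [int n = a ^ r * g] (mod int p) \<or> [- int n = a ^ r * g] (mod int p)"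
  have prod: "\<exists>g\<in>G. ?R (prod_mset M) (size M) g" if "set_mset M \<subseteq> H" for M
    using that
  proof (induction M)
    case empty
    then show ?case using assms(2) by (intro bexI[of _ 1]) auto
  next
    case (add h M)
    obtain g1 where g1: "g1 \<in> G" "[int h = a * g1] (mod int p) \<or> [- int h = a * g1] (mod int p)"
      using H add.prems by auto
    obtain g2 where g2: "g2 \<in> G" "?R (prod_mset M) (size M) g2"
      using add by auto
    let ?g = "(g1 * g2) mod int p"
    have *: "[x * y = a ^ Suc (size M) * ?g] (mod int p)"
      if "[x = a * g1] (mod int p)" "[y = a ^ size M * g2] (mod int p)" for x y
    proof -
      have "[x * y = a * g1 * (a ^ size M * g2)] (mod int p)"
        using that by (rule cong_mult)
      moreover have "[a ^ Suc (size M) * ?g = a ^ Suc (size M) * (g1 * g2)] (mod int p)"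
        by (intro cong_mult) (auto simp: cong_def)
      ultimately show ?thesis by (simp add: algebra_simps cong_def)
    qed
    have "?R (prod_mset (add_mset h M)) (size (add_mset h M)) ?g"
      \<comment> \<open>The four instances are the four combinations of signs.\<close>
      using g1(2) g2(2) *[of "int h" "int (prod_mset M)"] *[of "- int h" "int (prod_mset M)"]
        *[of "int h" "- int (prod_mset M)"] *[of "- int h" "- int (prod_mset M)"]
      by auto
    then show ?case using mult g1(1) g2(1) by blast
  qed
  let ?N = "prod_mset ` multisets_of_size H r"
  have bound: "0 < n \<and> n \<le> k ^ r" if n: "n \<in> ?N" for n
  proof -
    obtain M where M: "n = prod_mset M" "set_mset M \<subseteq> {1..k}" "size M = r"
      using n pos by (auto simp: multisets_of_size_def)
    from M(2) have "0 < prod_mset M \<and> prod_mset M \<le> k ^ size M"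
      by (induction M) (auto intro: mult_le_mono)
    then show ?thesis using M by simp
  qed
  have "\<forall>n\<in>?N. \<exists>g\<in>G. ?R n r g"
    using prod by (auto simp: multisets_of_size_def)
  then obtain \<gamma> where \<gamma>: "\<And>n. n \<in> ?N \<Longrightarrow> \<gamma> n \<in> G \<and> ?R n r (\<gamma> n)"
    by metis
  have "inj_on \<gamma> ?N"
  proof (rule inj_onI)
    fix m n assume mn: "m \<in> ?N" "n \<in> ?N" "\<gamma> m = \<gamma> n"
    have b: "0 < m" "m \<le> k ^ r" "0 < n" "n \<le> k ^ r" using bound mn(1,2) by auto
    have "[int m = int n] (mod int p) \<or> [int m = - int n] (mod int p)"
      using \<gamma>[OF mn(1)] \<gamma>[OF mn(2)] mn(3) cong_minus_minus_iff[of "int m" "- int n" "int p"]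
        cong_minus_minus_iff[of "int m" "int n" "int p"]
      by (simp add: cong_def) metis
    then show "m = n"
    proof
      assume "[int m = int n] (mod int p)"
      then have "[m = n] (mod p)" by (simp add: cong_int_iff)
      moreover have "m < p" "n < p" using b kr by linarith+
      ultimately show ?thesis by (simp add: cong_def)
    next
      \<comment> \<open>Here \<open>p\<close> divides \<open>m + n\<close>, while
        \<open>m + n\<close> is positive and at most \<open>2 * k ^ r\<close>, hence at most
        \<open>p\<close>. Equality must hold, so both numbers equal \<open>k ^ r\<close>.\<close>
      assume "[int m = - int n] (mod int p)"
      then have "int p dvd int (m + n)" by (simp add: cong_iff_dvd_diff)
      then have "p \<le> m + n" using b by (intro dvd_imp_le) (simp_all only: int_dvd_int_iff)
      then show ?thesis using b kr by linarith
    qed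
  qed
  then show ?thesis using \<gamma> assms(1) by (intro card_inj_on_le) auto
qed

section \<open>The bound for the heights\<close>

theorem theorem1p1:
  fixes p t k s :: nat and a :: int
  assumes "prime p" and "p > 2"
    and "t > 0" and "t dvd p - 1"
    and "1 < k" and "real k < real p / 2"
    and "a \<in> carrier (Fp_star p)"
    and "s = s0 p k t"
  shows "card (height p ` U p k t a) \<le> smooth_count (real k) (real (nth_prime (s + 1)))"
proof -
  define G where "G = subgroup_of_order p t"
  define H where "H = height p ` U p k t a"
  define r where "r = r0 p k"
  interpret residues_prime p "Fp p"
    by (simp add: residues_prime_def assms)
  have G: "subgroup G (Fp_star p)" "card G = t"
    using theI'[OF ex1_subgroup_of_order[OF assms(1,3,4)]]
    unfolding G_def subgroup_of_order_def by auto
  have finG: "finite G" using G(2) assms(3) by (metis card.infinite less_irrefl)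
  have one: "1 \<in> G" using subgroup.one_closed[OF G(1)] by (simp add: res_one_eq)
  have mult: "(g * h) mod int p \<in> G" if "g \<in> G" "h \<in> G" for g h
    using subgroup.m_closed[OF G(1) that] by (simp add: res_mult_eq)
  have cosetH: "\<exists>g\<in>G. [int h = a * g] (mod int p) \<or> [- int h = a * g] (mod int p)"
    and Hpos: "1 \<le> h \<and> h \<le> k" if h: "h \<in> H" for h
  proof -
    obtain x where x: "x \<in> U p k t a" "h = height p x" using h H_def by auto
    then obtain g where g: "g \<in> G" "x = (a * g) mod int p"
      by (auto simp: U_def l_coset_def G_def res_mult_eq)
    show "\<exists>g\<in>G. [int h = a * g] (mod int p) \<or> [- int h = a * g] (mod int p)"
      using height_cong[of p x] g x(2) by (intro bexI[of _ g]) (auto simp: cong_def)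
    have "g \<in> carrier (Fp_star p)" using g(1) G(1) by (meson subgroup.mem_carrier)
    then have "a \<otimes>\<^bsub>Fp_star p\<^esub> g \<in> carrier (Fp_star p)"
      using assms(7) field_mult_group by (meson group.subgroup_self subgroup.m_closed)
    then have "x \<in> carrier (Fp p)" "x \<noteq> 0"
      using g(2) by (auto simp: res_mult_eq res_zero_eq)
    then have "\<not> [0 = x] (mod int p)" by (auto simp: res_carrier_eq cong_def)
    then have "h \<noteq> 0" using height_cong[of p x] x(2) by (metis add.inverse_neutral of_nat_0)
    then show "1 \<le> h \<and> h \<le> k" using x by (auto simp: U_def)
  qed
  have kr: "2 * k ^ r \<le> p"
  proof -
    \<comment> \<open>Nonnegativity ensures that \<open>nat\<close> in \<open>r0\<close> does not
      round upwards.\<close>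
    have "ln (real p / 2) / ln (real k) \<ge> 0" using assms by simp
    then have "real r \<le> ln (real p / 2) / ln (real k)"
      unfolding r_def r0_def by linarith
    then have "ln (real k ^ r) \<le> ln (real p / 2)"
      using assms(5) by (simp add: ln_realpow field_simps)
    then have "real k ^ r \<le> real p / 2"
      using assms(2,5) by (subst (asm) ln_le_cancel_iff) auto
    then have "real (2 * k ^ r) \<le> real p" by simp
    then show ?thesis by (simp only: of_nat_le_iff)
  qed
  have Hsub: "H \<subseteq> {1..k}" using Hpos by auto
  obtain B where B: "B \<subseteq> exponent_vector ` H" "funs.independent B"
      "exponent_vector ` H \<subseteq> funs.span B"
    using funs.maximal_independent_subset by blast
  obtain A where A: "A \<subseteq> H" "B = exponent_vector ` A"
    using B(1) by (meson subset_imageE)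
  have finA: "finite A" "0 \<notin> A" using A(1) Hsub by (auto intro: finite_subset)
  have cardA: "card A \<le> s + 1"
  proof (cases "A = {}")
    case False
    \<comment> \<open>From \<open>m + 1\<close> elements there are \<open>(r + m) choose r\<close>
      multisets of size \<open>r\<close>. This shift by one is why \<open>s + 1\<close> primes
      appear in the bound.\<close>
    define m where "m = card A - 1"
    have m: "card A = m + 1" using False finA by (simp add: m_def Suc_leI card_gt_0_iff)
    have "inj_on prod_mset (multisets_of_size A r)"
      using inj_on_prod_mset_independent[of A] finA B(2) A(2)
      by (auto simp: multisets_of_size_def intro: inj_on_subset)
    then have "card (multisets_of_size A r) = card (prod_mset ` multisets_of_size A r)"
      by (simp add: card_image)
    also have "\<dots> \<le> card G"
      using A(1) Hsub by (intro card_height_products_le[OF finG one mult cosetH _ kr]) auto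
    finally have "(r + m) choose r \<le> t"
      using finA m G(2) by (simp add: card_multisets_of_size add.commute)
    then have "(r + m) choose m \<le> t"
      using binomial_symmetric[of r "r + m"] by simp
    then have "m \<le> s"
      unfolding assms(8) s0_def r_def
      using s0_set_finite_nonempty(1)[OF assms(5,6,3)] by (intro Max_ge) auto
    then show ?thesis using m by simp
  qed simp
  have "finite B" "card B \<le> card A" using A(2) finA card_image_le by auto
  then obtain Q where Q: "finite Q" "card Q \<le> card A"
      "\<And>f. f \<in> funs.span B \<Longrightarrow> \<forall>q\<in>Q. f q = 0 \<Longrightarrow> f = 0"
    using span_determined_by_few_coordinates[of B] by (metis order.trans)
  \<comment> \<open>The coordinates found by linear algebra may include non-primes. All exponent
    vectors vanish there, so only the primes are kept.\<close>
  let ?Q = "Q \<inter> {q. prime q}"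
  have "card H \<le> smooth_count (real k) (real (nth_prime (s + 1)))"
  proof (rule card_le_smooth_count[OF Hsub, of ?Q])
    show "card ?Q \<le> s + 1"
      using Q(1,2) cardA card_mono[of Q ?Q] by auto
    fix m n assume mn: "m \<in> H" "n \<in> H"
      "\<And>q. q \<in> ?Q \<Longrightarrow> multiplicity q m = multiplicity q n"
    have "exponent_vector m - exponent_vector n \<in> funs.span B"
      using mn(1,2) B(3) by (intro funs.span_diff) auto
    moreover have "\<forall>q\<in>Q. (exponent_vector m - exponent_vector n) q = 0"
      using mn(3) by (auto simp: exponent_vector_def count_prime_factorization)
    ultimately have "exponent_vector m - exponent_vector n = 0" by (rule Q(3))
    then have "exponent_vector m = exponent_vector n" by simp
    then show "m = n"
      using exponent_vector_eq_iff Hpos mn(1,2) by (metis less_le_trans zero_less_one)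
  qed (use Q(1) in auto)
  then show ?thesis by (simp add: H_def)
qed

end
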